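(* Let $X$ and $Y$ be Hausdorff topological spaces and let $f:X\rightarrow Y$ be a perfect map, i.e. a continuous surjection which is closed and such that $f^{-1}(y)$ is compact for every $y\in Y$. If $X$ has a uniform base at non-isolated points, then $Y$ has a uniform base at non-isolated points.
   Context: A base $\mathcal{P}$ of a topological space $X$ is called a uniform base at non-isolated points for $X$ if for each non-isolated point $x\in X$ and each countably infinite subset $\mathcal{P}'$ of $\{P\in\mathcal{P}:x\in P\}$, the family $\mathcal{P}'$ is a neighborhood base at $x$ in $X$. All spaces are assumed to be Hausdorff and all maps are continuous and onto. *)

theory Defs
  imports "HOL-Analysis.Analysis"
begin

definition base_of :: "'a topology \<Rightarrow> 'a set set \<Rightarrow> bool" where
  "base_of X \<P> \<longleftrightarrow> openin X = arbitrary union_of (\<lambda>U. U \<in> \<P>)"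

definition isolated_point :: "'a topology \<Rightarrow> 'a \<Rightarrow> bool" where
  "isolated_point X x \<longleftrightarrow> openin X {x}"

text \<open>The library predicate \<^const>\<open>neighbourhood_base_at\<close> only demands that the family
  contain arbitrarily small neighbourhoods of \<open>x\<close>; here every member must in addition
  be a neighbourhood of \<open>x\<close>.\<close>

definition nbhd_base_at :: "'a topology \<Rightarrow> 'a \<Rightarrow> 'a set set \<Rightarrow> bool" where
  "nbhd_base_at X x \<N> \<longleftrightarrow>
     (\<forall>N\<in>\<N>. N \<subseteq> topspace X \<and> (\<exists>U. openin X U \<and> x \<in> U \<and> U \<subseteq> N)) \<and>
     (\<forall>U. openin X U \<and> x \<in> U \<longrightarrow> (\<exists>N\<in>\<N>. N \<subseteq> U))"

definition uniform_base_at_nonisolated :: "'a topology \<Rightarrow> 'a set set \<Rightarrow> bool" where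
  "uniform_base_at_nonisolated X \<P> \<longleftrightarrow>
     base_of X \<P> \<and>
     (\<forall>x\<in>topspace X. \<not> isolated_point X x \<longrightarrow>
        (\<forall>\<P>'. \<P>' \<subseteq> {P \<in> \<P>. x \<in> P} \<and> countable \<P>' \<and> infinite \<P>' \<longrightarrow> nbhd_base_at X x \<P>'))"

definition has_uniform_base_at_nonisolated :: "'a topology \<Rightarrow> bool" where
  "has_uniform_base_at_nonisolated X \<longleftrightarrow> (\<exists>\<P>. uniform_base_at_nonisolated X \<P>)"

end

theory Submission
  imports Defs
begin

text \<open>
  Let \<open>X'\<close> be the closed set of non-isolated points of \<open>X\<close> and \<open>Y' = f(X')\<close>, which contains
  all non-isolated points of \<open>Y\<close>. Maximal members of a uniform base give point-finite open
  refinements on \<open>X'\<close>, and hence a sequence of point-finite open covers \<open>\<U>\<^sub>n\<close> of \<open>X'\<close> whose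
  stars shrink to every point of \<open>X'\<close>.

  Let \<open>H\<^sub>n(x)\<close> be the intersection of the members of \<open>\<U>\<^sub>0, \<dots>, \<U>\<^sub>n\<close> containing \<open>x\<close>, or \<open>{x}\<close> if
  \<open>x\<close> is isolated. The sets of all \<open>y\<close> whose fibre lies in the union of the \<open>H\<^sub>n(x)\<close> with
  \<open>f(x) = z\<close> form, for \<open>z \<in> Y'\<close>, covers of \<open>Y'\<close> whose stars shrink as well, by compactness of
  the fibres. Point-finite refinements of these covers, together with the isolated points,
  constitute the required base of \<open>Y\<close>.

  That open covers of \<open>Y'\<close> have point-finite open refinements is the crux. Given a
  point-finite open cover \<open>\<U>\<close> of \<open>X'\<close>, let \<open>\<Phi>(z)\<close> be the set of subcovers of the fibre of \<open>z\<close>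
  in \<open>X'\<close> of minimum cardinality \<open>k(z)\<close>; it is finite. On the stratum where \<open>k(z)\<close> and
  \<open>|\<Phi>(z)|\<close> are fixed, \<open>\<Phi>\<close> is locally constant, so the classes of \<open>\<Phi>\<close> can be expanded to a
  point-finite open family. The countably many families so obtained are made jointly
  point-finite by removing closed sets.
\<close>

section \<open>Non-isolated points, point-finite families and developments\<close>

definition nonisolated :: "'a topology \<Rightarrow> 'a set" where
  "nonisolated X = {x \<in> topspace X. \<not> isolated_point X x}"

definition point_finite_on :: "'a set \<Rightarrow> 'a set set \<Rightarrow> bool" where
  "point_finite_on S \<U> \<longleftrightarrow> (\<forall>x\<in>S. finite {U \<in> \<U>. x \<in> U})"

text \<open>Successive covers need not refine one another, so the stars at \<open>x\<close> are
  required to be small for all late \<open>n\<close>, not for one \<open>n\<close> only.\<close>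

definition development_on :: "'a topology \<Rightarrow> 'a set \<Rightarrow> (nat \<Rightarrow> 'a set set) \<Rightarrow> bool" where
  "development_on X S \<U> \<longleftrightarrow>
     (\<forall>n. (\<forall>U\<in>\<U> n. openin X U) \<and> S \<subseteq> \<Union>(\<U> n)) \<and>
     (\<forall>x\<in>S. \<forall>W. openin X W \<and> x \<in> W \<longrightarrow> (\<exists>n0. \<forall>n\<ge>n0. \<forall>U\<in>\<U> n. x \<in> U \<longrightarrow> U \<subseteq> W))"

lemma development_onD:
  assumes "development_on X S \<U>"
  shows "U \<in> \<U> n \<Longrightarrow> openin X U" "S \<subseteq> \<Union>(\<U> n)"
    "x \<in> S \<Longrightarrow> openin X W \<Longrightarrow> x \<in> W \<Longrightarrow> \<exists>n0. \<forall>n\<ge>n0. \<forall>U\<in>\<U> n. x \<in> U \<longrightarrow> U \<subseteq> W"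
  using assms unfolding development_on_def by blast+

lemma nonisolated_subset: "nonisolated X \<subseteq> topspace X"
  by (auto simp: nonisolated_def)

lemma closedin_nonisolated: "closedin X (nonisolated X)"
proof -
  have "x \<in> topspace X" if "openin X {x}" for x
    using openin_subset[OF that] by simp
  then have "topspace X - nonisolated X = \<Union> {{x} |x. openin X {x}}"
    by (auto simp: nonisolated_def isolated_point_def)
  moreover have "openin X (\<Union> {{x} |x. openin X {x}})"
    by (rule openin_Union) auto
  ultimately show ?thesis
    by (simp add: closedin_def nonisolated_subset)
qed

lemma base_of_alt:
  "base_of X \<P> \<longleftrightarrow>
     (\<forall>P\<in>\<P>. openin X P) \<and> (\<forall>W x. openin X W \<and> x \<in> W \<longrightarrow> (\<exists>P\<in>\<P>. x \<in> P \<and> P \<subseteq> W))"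
  (is "_ \<longleftrightarrow> ?r")
proof
  assume b: "base_of X \<P>"
  have "openin X P" if "P \<in> \<P>" for P
    using b that by (auto simp: base_of_def arbitrary_union_of_alt)
  moreover have "\<exists>P\<in>\<P>. x \<in> P \<and> P \<subseteq> W" if "openin X W" "x \<in> W" for W x
    using b that by (auto simp: base_of_def arbitrary_union_of_alt)
  ultimately show ?r by blast
next
  assume r: ?r
  have "openin X W \<longleftrightarrow> (arbitrary union_of (\<lambda>U. U \<in> \<P>)) W" for W
    unfolding arbitrary_union_of_alt using r openin_subopen[of X W] by metis
  then show "base_of X \<P>" by (auto simp: base_of_def)
qed

text \<open>Each of the finitely many members containing a fixed point of \<open>K\<close> reduces the problem to
  a smaller set, as in Miscenko's lemma.\<close>

lemma finite_minimum_covers: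
  assumes "\<And>x. x \<in> K \<Longrightarrow> finite {U \<in> \<U>. x \<in> U}"
    and "\<And>F. F \<subseteq> \<U> \<Longrightarrow> finite F \<Longrightarrow> K \<subseteq> \<Union>F \<Longrightarrow> k \<le> card F"
  shows "finite {F. F \<subseteq> \<U> \<and> finite F \<and> card F = k \<and> K \<subseteq> \<Union>F}"
  using assms
proof (induction k arbitrary: K)
  case 0
  have "{F. F \<subseteq> \<U> \<and> finite F \<and> card F = 0 \<and> K \<subseteq> \<Union>F} \<subseteq> {{}}" by auto
  then show ?case using finite_subset by blast
next
  case (Suc k)
  \<comment> \<open>Otherwise the empty family covers \<open>K\<close> with cardinality 0.\<close>
  then have "K \<noteq> {}" by fastforce
  then obtain x where x: "x \<in> K" by blast
  define C where "C U = {F. F \<subseteq> \<U> \<and> finite F \<and> card F = k \<and> K - U \<subseteq> \<Union>F}" for U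
  have fin: "finite (C U)" if "U \<in> \<U>" for U
    unfolding C_def
  proof (rule Suc.IH)
    show "finite {V \<in> \<U>. y \<in> V}" if "y \<in> K - U" for y
      using Suc.prems(1) that by auto
    fix F assume F: "F \<subseteq> \<U>" "finite F" "K - U \<subseteq> \<Union>F"
    \<comment> \<open>Adding \<open>U\<close> turns a cover of \<open>K - U\<close> into one of
      \<open>K\<close>, so the lower bound drops by at most one.\<close>
    have "Suc k \<le> card (insert U F)"
      using F that by (intro Suc.prems(2)) auto
    also have "\<dots> \<le> Suc (card F)" by (simp add: F card_insert_if)
    finally show "k \<le> card F" by simp
  qed
  have "{F. F \<subseteq> \<U> \<and> finite F \<and> card F = Suc k \<and> K \<subseteq> \<Union>F}
      \<subseteq> (\<Union>U\<in>{U \<in> \<U>. x \<in> U}. insert U ` C U)"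
  proof
    fix F assume "F \<in> {F. F \<subseteq> \<U> \<and> finite F \<and> card F = Suc k \<and> K \<subseteq> \<Union>F}"
    then have F: "F \<subseteq> \<U>" "finite F" "card F = Suc k" "K \<subseteq> \<Union>F" by auto
    then obtain U where U: "U \<in> F" "x \<in> U" using x by blast
    have "F - {U} \<in> C U" using F U by (auto simp: C_def)
    moreover have "F = insert U (F - {U})" using U by auto
    ultimately show "F \<in> (\<Union>U\<in>{U \<in> \<U>. x \<in> U}. insert U ` C U)"
      using U F by blast
  qed
  moreover have "finite (\<Union>U\<in>{U \<in> \<U>. x \<in> U}. insert U ` C U)"
    using Suc.prems(1)[OF x] fin by auto
  ultimately show ?case using finite_subset by blast
qed

section \<open>Uniform bases: finiteness properties and developments\<close>

locale uniform_base =
  fixes X :: "'a topology" and \<P> :: "'a set set"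
  assumes Hausdorff: "Hausdorff_space X"
    and uniform: "uniform_base_at_nonisolated X \<P>"
begin

lemma base: "base_of X \<P>"
  using uniform by (simp add: uniform_base_at_nonisolated_def)

lemma open_base: "P \<in> \<P> \<Longrightarrow> openin X P"
  using base by (simp add: base_of_alt)

lemma base_point: "openin X W \<Longrightarrow> x \<in> W \<Longrightarrow> \<exists>P\<in>\<P>. x \<in> P \<and> P \<subseteq> W"
  using base by (simp add: base_of_alt)

text \<open>A countably infinite subfamily of the exceptional members would be a neighbourhood base
  at \<open>x\<close> with no member inside \<open>W\<close>.\<close>

lemma finite_not_subset:
  assumes "x \<in> nonisolated X" "openin X W" "x \<in> W"
  shows "finite {Q \<in> \<P>. x \<in> Q \<and> \<not> Q \<subseteq> W}"
proof (rule ccontr)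
  assume "infinite {Q \<in> \<P>. x \<in> Q \<and> \<not> Q \<subseteq> W}"
  then obtain B where B: "B \<subseteq> {Q \<in> \<P>. x \<in> Q \<and> \<not> Q \<subseteq> W}" "infinite B" "countable B"
    using infinite_countable_subset' by blast
  then have "B \<subseteq> {Q \<in> \<P>. x \<in> Q}" by blast
  then have "nbhd_base_at X x B"
    using uniform assms(1) B by (simp add: uniform_base_at_nonisolated_def nonisolated_def)
  then show False
    using assms B unfolding nbhd_base_at_def by blast
qed

text \<open>A proper superset of \<open>P\<close> is a base member at \<open>x\<close> not contained
  in \<open>P\<close>, so \<open>finite_not_subset\<close> applies with
  \<open>W = P\<close>.\<close>

lemma finite_supersets:
  assumes "x \<in> nonisolated X" "P \<in> \<P>" "x \<in> P"
  shows "finite {Q \<in> \<P>. P \<subseteq> Q}"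
proof (rule finite_subset)
  show "{Q \<in> \<P>. P \<subseteq> Q} \<subseteq> insert P {Q \<in> \<P>. x \<in> Q \<and> \<not> Q \<subseteq> P}"
    using assms by auto
  show "finite (insert P {Q \<in> \<P>. x \<in> Q \<and> \<not> Q \<subseteq> P})"
    using finite_not_subset assms open_base by simp
qed

text \<open>The refinement consists of the maximal members of the base that lie in a member of \<open>\<O>\<close>.\<close>

lemma point_finite_refinement:
  assumes "\<And>V. V \<in> \<V> \<Longrightarrow> openin X V"
  obtains \<U> where "\<And>U. U \<in> \<U> \<Longrightarrow> openin X U" "\<And>U. U \<in> \<U> \<Longrightarrow> \<exists>V\<in>\<V>. U \<subseteq> V"
    "nonisolated X \<inter> \<Union>\<V> \<subseteq> \<Union>\<U>" "point_finite_on (nonisolated X) \<U>"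
proof
  define \<A> where "\<A> = {P \<in> \<P>. \<exists>V\<in>\<V>. P \<subseteq> V}"
  define \<U> where "\<U> = {P \<in> \<A>. \<forall>Q\<in>\<A>. P \<subseteq> Q \<longrightarrow> Q = P}"
  show "openin X U" if "U \<in> \<U>" for U
    using that open_base by (auto simp: \<U>_def \<A>_def)
  show "\<exists>V\<in>\<V>. U \<subseteq> V" if "U \<in> \<U>" for U
    using that by (auto simp: \<U>_def \<A>_def)
  show "nonisolated X \<inter> \<Union>\<V> \<subseteq> \<Union>\<U>"
  proof
    fix x assume "x \<in> nonisolated X \<inter> \<Union>\<V>"
    then obtain V where V: "x \<in> nonisolated X" "V \<in> \<V>" "x \<in> V" by blast
    then obtain P where P: "P \<in> \<P>" "x \<in> P" "P \<subseteq> V"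
      using base_point assms by blast
    have "finite {Q \<in> \<A>. P \<subseteq> Q}"
      by (rule finite_subset[OF _ finite_supersets[OF V(1) P(1,2)]]) (auto simp: \<A>_def)
    moreover have "P \<in> {Q \<in> \<A>. P \<subseteq> Q}" using P V by (auto simp: \<A>_def)
    ultimately obtain M where M: "M \<in> {Q \<in> \<A>. P \<subseteq> Q}" "P \<subseteq> M"
        "\<And>Q. Q \<in> {Q \<in> \<A>. P \<subseteq> Q} \<Longrightarrow> M \<subseteq> Q \<Longrightarrow> M = Q"
      using finite_has_maximal2[of "{Q \<in> \<A>. P \<subseteq> Q}" P] by auto
    \<comment> \<open>A member of \<open>\<A>\<close> above \<open>M\<close> is also above
      \<open>P\<close>, so maximality above \<open>P\<close> is maximality in
      \<open>\<A>\<close>.\<close>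
    then have "M \<in> \<U>" by (force simp: \<U>_def)
    then show "x \<in> \<Union>\<U>" using M(2) P by blast
  qed
  show "point_finite_on (nonisolated X) \<U>"
    unfolding point_finite_on_def
  proof
    fix x assume x: "x \<in> nonisolated X"
    show "finite {U \<in> \<U>. x \<in> U}"
    proof (cases "\<exists>M\<in>\<U>. x \<in> M")
      case True
      then obtain M where M: "M \<in> \<U>" "x \<in> M" by blast
      \<comment> \<open>Maximal members are never properly nested, so every other member at
        \<open>x\<close> is among the finitely many base members not inside
        \<open>M\<close>.\<close>
      have "U = M" if "U \<in> \<U>" "U \<subseteq> M" for U
        using that M by (simp add: \<U>_def)
      then have "{U \<in> \<U>. x \<in> U} \<subseteq> insert M {Q \<in> \<P>. x \<in> Q \<and> \<not> Q \<subseteq> M}"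
        by (auto simp: \<U>_def \<A>_def)
      moreover have "finite {Q \<in> \<P>. x \<in> Q \<and> \<not> Q \<subseteq> M}"
        using M x open_base by (intro finite_not_subset) (auto simp: \<U>_def \<A>_def)
      ultimately show ?thesis using finite_subset by blast
    next
      case False
      then have "{U \<in> \<U>. x \<in> U} = {}" by blast
      then show ?thesis by (metis finite.emptyI)
    qed
  qed
qed

text \<open>Finitely many base members at \<open>x\<close> would have an open intersection, which
  the Hausdorff property reduces to \<open>{x}\<close>.\<close>

lemma infinite_base_at:
  assumes x: "x \<in> nonisolated X"
  shows "infinite {P \<in> \<P>. x \<in> P}"
proof
  assume fin: "finite {P \<in> \<P>. x \<in> P}"
  have xt: "x \<in> topspace X" using x nonisolated_subset[of X] by blast
  then have ne: "{P \<in> \<P>. x \<in> P} \<noteq> {}"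
    using base_point[OF openin_topspace] by blast
  have op: "openin X (\<Inter>{P \<in> \<P>. x \<in> P})"
    by (rule openin_Inter[OF fin ne]) (simp add: open_base)
  have "y = x" if y: "y \<in> \<Inter>{P \<in> \<P>. x \<in> P}" for y
  proof (rule ccontr)
    assume "y \<noteq> x"
    moreover have "y \<in> topspace X" using op openin_subset y by blast
    ultimately obtain A B where "openin X A" "openin X B" "x \<in> A" "y \<in> B" "disjnt A B"
      using Hausdorff xt unfolding Hausdorff_space_def by metis
    then obtain P where "P \<in> \<P>" "x \<in> P" "P \<subseteq> A" using base_point by blast
    then show False using y \<open>y \<in> B\<close> \<open>disjnt A B\<close> by (auto simp: disjnt_def)
  qed
  then have "\<Inter>{P \<in> \<P>. x \<in> P} = {x}" by auto
  then show False using op x by (simp add: nonisolated_def isolated_point_def)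
qed

text \<open>The \<open>n\<close>-th cover refines the family of base members that have at least \<open>n\<close> supersets in
  the base.\<close>

lemma development:
  obtains \<U> where "development_on X (nonisolated X) \<U>"
    "\<And>n. point_finite_on (nonisolated X) (\<U> n)"
proof -
  \<comment> \<open>\<open>card\<close> gives 0 for an infinite family, but a member containing a
    non-isolated point has only finitely many supersets.\<close>
  define h where "h P = card {Q \<in> \<P>. P \<subseteq> Q}" for P
  define L where "L n = {P \<in> \<P>. n \<le> h P}" for n
  have cover: "nonisolated X \<subseteq> \<Union>(L n)" for n
  proof
    fix x assume x: "x \<in> nonisolated X"
    define B where "B = {P \<in> \<P>. x \<in> P}"
    have "\<exists>P\<in>B. n \<le> h P"
    proof (rule ccontr)
      assume "\<not> ?thesis"
      then have bound: "h P < n" if "P \<in> B" for P using that by force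
      have inf: "infinite B" unfolding B_def using infinite_base_at x by simp
      then have "B \<noteq> {}" by auto
      \<comment> \<open>Bounded heights yield a \<open>P\<close> of maximal height. As all but
        finitely many members at \<open>x\<close> lie inside \<open>P\<close>, some \<open>Q\<close>
        is properly inside; it counts itself as an extra superset, so its height is larger.\<close>
      have "finite (h ` B)" by (rule finite_subset[of _ "{..<n}"]) (use bound in auto)
      then have "Max (h ` B) \<in> h ` B" using \<open>B \<noteq> {}\<close> by simp
      then obtain P where P: "P \<in> B" "h P = Max (h ` B)" by auto
      have "finite {Q \<in> \<P>. x \<in> Q \<and> \<not> Q \<subseteq> P}"
        using P x open_base by (intro finite_not_subset) (auto simp: B_def)
      then have "\<not> B \<subseteq> insert P {Q \<in> \<P>. x \<in> Q \<and> \<not> Q \<subseteq> P}"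
        using inf finite_subset by blast
      then obtain Q where Q: "Q \<in> B" "Q \<noteq> P" "Q \<subseteq> P" by (auto simp: B_def)
      have "h P < h Q"
        unfolding h_def using Q P x
        by (intro psubset_card_mono finite_supersets[of x]) (auto simp: B_def)
      moreover have "h Q \<le> h P" using P Q \<open>finite (h ` B)\<close> by simp
      ultimately show False by simp
    qed
    then show "x \<in> \<Union>(L n)" by (auto simp: L_def B_def)
  qed
  have small: "\<exists>n0. \<forall>n\<ge>n0. \<forall>P\<in>L n. x \<in> P \<longrightarrow> P \<subseteq> W"
    if "x \<in> nonisolated X" "openin X W" "x \<in> W" for x W
  proof -
    have fin: "finite (h ` {Q \<in> \<P>. x \<in> Q \<and> \<not> Q \<subseteq> W})"
      using finite_not_subset[OF that] by simp
    \<comment> \<open>The inserted 0 keeps \<open>Max\<close> meaningful when no member is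
      exceptional; \<open>Suc\<close> puts \<open>n0\<close> above all exceptional heights.\<close>
    define n0 where "n0 = Suc (Max (insert 0 (h ` {Q \<in> \<P>. x \<in> Q \<and> \<not> Q \<subseteq> W})))"
    have "P \<subseteq> W" if "n0 \<le> n" "P \<in> L n" "x \<in> P" for n P
    proof (rule ccontr)
      assume "\<not> P \<subseteq> W"
      then have "h P \<le> Max (insert 0 (h ` {Q \<in> \<P>. x \<in> Q \<and> \<not> Q \<subseteq> W}))"
        using that fin by (intro Max_ge) (auto simp: L_def)
      then show False using that by (simp add: n0_def L_def)
    qed
    then show ?thesis by blast
  qed
  have "\<exists>\<U>. (\<forall>U\<in>\<U>. openin X U) \<and> (\<forall>U\<in>\<U>. \<exists>V\<in>L n. U \<subseteq> V) \<and>
      nonisolated X \<inter> \<Union>(L n) \<subseteq> \<Union>\<U> \<and> point_finite_on (nonisolated X) \<U>" for n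
    using point_finite_refinement[of "L n"] open_base by (metis (no_types, lifting) L_def mem_Collect_eq)
  then obtain \<U> where \<U>: "\<And>n. (\<forall>U\<in>\<U> n. openin X U) \<and> (\<forall>U\<in>\<U> n. \<exists>V\<in>L n. U \<subseteq> V) \<and>
      nonisolated X \<inter> \<Union>(L n) \<subseteq> \<Union>(\<U> n) \<and> point_finite_on (nonisolated X) (\<U> n)"
    by metis
  have "\<exists>n0. \<forall>n\<ge>n0. \<forall>U\<in>\<U> n. x \<in> U \<longrightarrow> U \<subseteq> W"
    if x: "x \<in> nonisolated X" "openin X W" "x \<in> W" for x W
  proof -
    obtain n0 where n0: "\<And>n P. n \<ge> n0 \<Longrightarrow> P \<in> L n \<Longrightarrow> x \<in> P \<Longrightarrow> P \<subseteq> W"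
      using small[OF x] by metis
    have "U \<subseteq> W" if "n0 \<le> n" "U \<in> \<U> n" "x \<in> U" for n U
    proof -
      have "\<exists>P\<in>L n. U \<subseteq> P" using \<U> \<open>U \<in> \<U> n\<close> by simp
      then obtain P where "P \<in> L n" "U \<subseteq> P" ..
      then show ?thesis using n0[of n P] that(1,3) by blast
    qed
    then show ?thesis by blast
  qed
  moreover have "nonisolated X \<subseteq> \<Union>(\<U> n)" for n using \<U>[of n] cover[of n] by blast
  ultimately have "development_on X (nonisolated X) \<U>"
    using \<U> by (simp add: development_on_def)
  then show thesis using \<U> by (intro that) auto
qed

end

section \<open>Perfect maps and their fibres\<close>

locale perfect_image = uniform_base X \<P>
  for X :: "'a topology" and \<P> +
  fixes Y :: "'b topology" and f :: "'a \<Rightarrow> 'b"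
  assumes perfect: "perfect_map X Y f"
begin

abbreviation X' where "X' \<equiv> nonisolated X"
abbreviation Y' where "Y' \<equiv> f ` nonisolated X"

lemma continuous: "continuous_map X Y f"
  and closed: "closed_map X Y f"
  and surj: "f ` topspace X = topspace Y"
  and compact_fibre: "y \<in> topspace Y \<Longrightarrow> compactin X {x \<in> topspace X. f x = y}"
  using perfect by (auto simp: perfect_map_def proper_map_def)

lemma Y'_subset: "Y' \<subseteq> topspace Y"
  using surj nonisolated_subset[of X] by blast

text \<open>The complement is the image of the closed set \<open>C - A\<close>. With
  \<open>C = X'\<close> only the non-isolated part of a fibre is tested, with
  \<open>C = topspace X\<close> the whole fibre.\<close>

lemma openin_fibres_within:
  assumes "closedin X C" "openin X A"
  shows "openin Y {y \<in> topspace Y. \<forall>x\<in>C. f x = y \<longrightarrow> x \<in> A}"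
proof -
  have "closedin Y (f ` (C - A))"
    using closed assms by (auto simp: closed_map_def intro: closedin_diff)
  moreover have "{y \<in> topspace Y. \<forall>x\<in>C. f x = y \<longrightarrow> x \<in> A} = topspace Y - f ` (C - A)"
    by auto
  ultimately show ?thesis by auto
qed

lemma openin_preimage: "openin Y V \<Longrightarrow> openin X {x \<in> topspace X. f x \<in> V}"
  using continuous by (rule openin_continuous_map_preimage)

text \<open>A fibre consisting of isolated points is open, and closedness of \<open>f\<close> then
  makes \<open>{y}\<close> open.\<close>

lemma nonisolated_image: "nonisolated Y \<subseteq> Y'"
proof
  fix y assume y: "y \<in> nonisolated Y"
  then have yt: "y \<in> topspace Y" using nonisolated_subset[of Y] by blast
  show "y \<in> Y'"
  proof (rule ccontr)
    assume "y \<notin> Y'"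
    let ?K = "{x \<in> topspace X. f x = y}"
    have "openin X {x}" if "x \<in> ?K" for x
      using \<open>y \<notin> Y'\<close> that by (auto simp: nonisolated_def isolated_point_def)
    then have "openin X (\<Union>x\<in>?K. {x})" by (intro openin_Union) blast
    then have "openin X ?K" by simp
    then have "openin Y {y' \<in> topspace Y. \<forall>x\<in>topspace X. f x = y' \<longrightarrow> x \<in> ?K}"
      by (intro openin_fibres_within) auto
    moreover have "{y' \<in> topspace Y. \<forall>x\<in>topspace X. f x = y' \<longrightarrow> x \<in> ?K} = {y}"
      using yt unfolding surj[symmetric] by auto
    ultimately show False using y by (simp add: nonisolated_def isolated_point_def)
  qed
qed

section \<open>Point-finite open refinements on \<open>Y'\<close>\<close>

text \<open>The preimages of the \<open>N z\<close> are refined by a family \<open>\<U>\<close>, point-finite on \<open>X'\<close>, each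
  of whose members meets the preimage of at most one class of \<open>c\<close>.\<close>

lemma discrete_expansion:
  assumes S: "S \<subseteq> Y'"
    and N: "\<And>z. z \<in> S \<Longrightarrow> openin Y (N z)" "\<And>z. z \<in> S \<Longrightarrow> z \<in> N z"
    and c: "\<And>z z'. z \<in> S \<Longrightarrow> z' \<in> S \<Longrightarrow> z' \<in> N z \<Longrightarrow> c z' = c z"
  shows "\<exists>Q. (\<forall>d. openin Y (Q d)) \<and> (\<forall>z\<in>S. z \<in> Q (c z)) \<and>
    (\<forall>y\<in>Y'. finite {d \<in> c ` S. y \<in> Q d})"
proof -
  obtain \<U> where \<U>: "\<And>U. U \<in> \<U> \<Longrightarrow> openin X U"
      "\<And>U. U \<in> \<U> \<Longrightarrow> \<exists>V\<in>(\<lambda>z. {x \<in> topspace X. f x \<in> N z}) ` S. U \<subseteq> V"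
      "X' \<inter> \<Union>((\<lambda>z. {x \<in> topspace X. f x \<in> N z}) ` S) \<subseteq> \<Union>\<U>" "point_finite_on X' \<U>"
    using point_finite_refinement[of "(\<lambda>z. {x \<in> topspace X. f x \<in> N z}) ` S"]
      openin_preimage N(1) by blast
  define St where "St d = \<Union>{U \<in> \<U>. \<exists>x\<in>U. f x \<in> S \<and> c (f x) = d}" for d
  define Q where "Q d = {y \<in> topspace Y. \<forall>x\<in>X'. f x = y \<longrightarrow> x \<in> St d}" for d
  show ?thesis
  proof (intro exI[of _ Q] conjI allI ballI)
    show "openin Y (Q d)" for d
      unfolding Q_def St_def
      by (intro openin_fibres_within closedin_nonisolated openin_Union) (auto simp: \<U>)
    show "z \<in> Q (c z)" if z: "z \<in> S" for z
    proof -
      have "x \<in> St (c z)" if x: "x \<in> X'" "f x = z" for x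
      proof -
        have "x \<in> \<Union>\<U>" using \<U>(3) x z N(2)[OF z] nonisolated_subset[of X] by blast
        then show ?thesis using x z by (auto simp: St_def)
      qed
      then show ?thesis using z S Y'_subset by (auto simp: Q_def)
    qed
    show "finite {d \<in> c ` S. y \<in> Q d}" if y: "y \<in> Y'" for y
    proof -
      obtain x where x: "x \<in> X'" "f x = y" using y by blast
      \<comment> \<open>The class is unique if \<open>U\<close> meets the preimage of
        \<open>S\<close>: then \<open>U\<close> lies over a single \<open>N z\<close>, on which
        \<open>c\<close> is constant within \<open>S\<close>.\<close>
      define g where "g U = (THE d. \<exists>x'\<in>U. f x' \<in> S \<and> c (f x') = d)" for U
      have g: "g U = c (f x')" if "U \<in> \<U>" "x' \<in> U" "f x' \<in> S" for U x'
      proof -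
        obtain z where z: "z \<in> S" "U \<subseteq> {x \<in> topspace X. f x \<in> N z}"
          using \<U>(2)[OF \<open>U \<in> \<U>\<close>] by blast
        have "c (f x'') = c z" if "x'' \<in> U" "f x'' \<in> S" for x''
          using c[OF z(1) that(2)] z that by blast
        then show ?thesis unfolding g_def using that by (intro the_equality) auto
      qed
      \<comment> \<open>One point \<open>x\<close> over \<open>y\<close> suffices: if
        \<open>y\<close> is in \<open>Q d\<close>, then \<open>x\<close> is in a member of
        \<open>\<U>\<close> that determines \<open>d\<close>.\<close>
      have "{d \<in> c ` S. y \<in> Q d} \<subseteq> g ` {U \<in> \<U>. x \<in> U}"
      proof
        fix d assume "d \<in> {d \<in> c ` S. y \<in> Q d}"
        then have "x \<in> St d" using x by (auto simp: Q_def)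
        then obtain U x' where U: "U \<in> \<U>" "x \<in> U" "x' \<in> U" "f x' \<in> S" "c (f x') = d"
          by (auto simp: St_def)
        then have "d = g U" using g[of U x'] by simp
        then show "d \<in> g ` {U \<in> \<U>. x \<in> U}" using U by blast
      qed
      moreover have "finite (g ` {U \<in> \<U>. x \<in> U})"
        using \<U>(4) x by (simp add: point_finite_on_def)
      ultimately show ?thesis using finite_subset by blast
    qed
  qed
qed

text \<open>From the \<open>i\<close>-th family one removes a closed set \<open>D i\<close> covered by the previous families,
  chosen so that every point of \<open>Y'\<close> lies in almost all \<open>D i\<close>.\<close>

lemma glue_point_finite:
  fixes \<Q> :: "nat \<Rightarrow> 'b set set"
  assumes op: "\<And>i Q. Q \<in> \<Q> i \<Longrightarrow> openin Y Q"
    and pf: "\<And>i. point_finite_on Y' (\<Q> i)"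
    and cov: "Y' \<subseteq> (\<Union>i. \<Union>(\<Q> i))"
  obtains \<R> where "\<And>R. R \<in> \<R> \<Longrightarrow> openin Y R" "\<And>R. R \<in> \<R> \<Longrightarrow> \<exists>i. \<exists>Q\<in>\<Q> i. R \<subseteq> Q"
    "Y' \<subseteq> \<Union>\<R>" "point_finite_on Y' \<R>"
proof -
  obtain \<U> where dev: "development_on X X' \<U>" and pf_U: "\<And>n. point_finite_on X' (\<U> n)"
    using development by blast
  note \<U> = development_onD(1,2)[OF dev] pf_U development_onD(3)[OF dev]
  define G where "G i = (\<Union>l<i. \<Union>(\<Q> l))" for i
  define preG where "preG i = {x \<in> topspace X. f x \<in> G i}" for i
  have preG: "openin X (preG i)" for i
    unfolding preG_def G_def using op by (intro openin_preimage openin_Union) auto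
  \<comment> \<open>These are the points of \<open>X'\<close> whose star in \<open>\<U> i\<close>
    lies over \<open>G i\<close>. Since \<open>\<U> i\<close> covers \<open>X'\<close>, such points
    themselves lie over \<open>G i\<close>.\<close>
  define C where "C i = X' - \<Union>{U \<in> \<U> i. \<not> U \<subseteq> preG i}" for i
  have "closedin X (C i)" for i
    unfolding C_def by (intro closedin_diff closedin_nonisolated openin_Union) (auto simp: \<U>)
  then have D: "closedin Y (f ` C i)" for i using closed by (auto simp: closed_map_def)
  have CG: "f ` C i \<subseteq> G i" for i
  proof -
    have "x \<in> preG i" if "x \<in> C i" for x
      using that \<U>(2)[of i] by (auto simp: C_def)
    then show ?thesis by (auto simp: preG_def)
  qed
  have ev: "\<exists>i0. \<forall>i\<ge>i0. y \<in> f ` C i" if y: "y \<in> Y'" for y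
  proof -
    obtain x where x: "x \<in> X'" "f x = y" using y by blast
    obtain l where "y \<in> \<Union>(\<Q> l)" using subsetD[OF cov y] by (rule UN_E)
    \<comment> \<open>From here the star of \<open>x\<close> eventually lies over
      \<open>G (Suc l)\<close>, and \<open>G\<close> is increasing.\<close>
    then have "x \<in> preG (Suc l)" using x nonisolated_subset[of X] by (auto simp: preG_def G_def)
    then obtain n0 where n0: "\<And>n U. n \<ge> n0 \<Longrightarrow> U \<in> \<U> n \<Longrightarrow> x \<in> U \<Longrightarrow> U \<subseteq> preG (Suc l)"
      using \<U>(4)[OF x(1) preG \<open>x \<in> preG (Suc l)\<close>] by metis
    have "y \<in> f ` C i" if i: "i \<ge> max n0 (Suc l)" for i
    proof -
      have "preG (Suc l) \<subseteq> preG i" using i by (fastforce simp: preG_def G_def)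
      then have "x \<in> C i" using n0[of i] i x by (auto simp: C_def)
      then show ?thesis using x by blast
    qed
    then show ?thesis by blast
  qed
  define \<R> where "\<R> = (\<Union>i. (\<lambda>Q. Q - f ` C i) ` \<Q> i)"
  show thesis
  proof
    show "openin Y R" if "R \<in> \<R>" for R
      using that D op by (auto simp: \<R>_def intro: openin_diff)
    show "\<exists>i. \<exists>Q\<in>\<Q> i. R \<subseteq> Q" if "R \<in> \<R>" for R
      using that by (fastforce simp: \<R>_def)
    show "Y' \<subseteq> \<Union>\<R>"
    proof
      fix y assume "y \<in> Y'"
      with cov have "y \<in> (\<Union>i. \<Union>(\<Q> i))" by (rule subsetD)
      then have "\<exists>i. y \<in> \<Union>(\<Q> i)" by simp
      \<comment> \<open>The first family covering \<open>y\<close> loses nothing at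
        \<open>y\<close>, since the set removed from its members lies in the union of the earlier
        families.\<close>
      then obtain i where i: "y \<in> \<Union>(\<Q> i)" "\<And>l. l < i \<Longrightarrow> y \<notin> \<Union>(\<Q> l)"
        using exists_least_iff[of "\<lambda>i. y \<in> \<Union>(\<Q> i)"] by blast
      then have "y \<notin> f ` C i" using CG[of i] by (auto simp: G_def)
      then show "y \<in> \<Union>\<R>" using i(1) by (auto simp: \<R>_def)
    qed
    show "point_finite_on Y' \<R>"
      unfolding point_finite_on_def
    proof
      fix y assume y: "y \<in> Y'"
      obtain i0 where i0: "\<And>i. i \<ge> i0 \<Longrightarrow> y \<in> f ` C i" using ev[OF y] by blast
      have "{R \<in> \<R>. y \<in> R} \<subseteq> (\<Union>i<i0. (\<lambda>Q. Q - f ` C i) ` {Q \<in> \<Q> i. y \<in> Q})"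
      proof
        fix R assume "R \<in> {R \<in> \<R>. y \<in> R}"
        then obtain i Q where R: "Q \<in> \<Q> i" "R = Q - f ` C i" "y \<in> R" by (auto simp: \<R>_def)
        then have "i < i0" using i0[of i] by (metis Diff_iff not_le)
        then show "R \<in> (\<Union>i<i0. (\<lambda>Q. Q - f ` C i) ` {Q \<in> \<Q> i. y \<in> Q})" using R by blast
      qed
      moreover have "finite (\<Union>i<i0. (\<lambda>Q. Q - f ` C i) ` {Q \<in> \<Q> i. y \<in> Q})"
        using pf y by (auto simp: point_finite_on_def)
      ultimately show "finite {R \<in> \<R>. y \<in> R}" using finite_subset by blast
    qed
  qed
qed

lemma point_finite_refinement_image:
  assumes \<V>: "\<And>V. V \<in> \<V> \<Longrightarrow> openin Y V" and cov: "Y' \<subseteq> \<Union>\<V>"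
  obtains \<R> where "\<And>R. R \<in> \<R> \<Longrightarrow> openin Y R" "\<And>R. R \<in> \<R> \<Longrightarrow> \<exists>V\<in>\<V>. R \<subseteq> V"
    "Y' \<subseteq> \<Union>\<R>" "point_finite_on Y' \<R>"
proof -
  obtain \<U> where \<U>: "\<And>U. U \<in> \<U> \<Longrightarrow> openin X U"
      "\<And>U. U \<in> \<U> \<Longrightarrow> \<exists>W\<in>(\<lambda>V. {x \<in> topspace X. f x \<in> V}) ` \<V>. U \<subseteq> W"
      "X' \<inter> \<Union>((\<lambda>V. {x \<in> topspace X. f x \<in> V}) ` \<V>) \<subseteq> \<Union>\<U>" "point_finite_on X' \<U>"
    using point_finite_refinement[of "(\<lambda>V. {x \<in> topspace X. f x \<in> V}) ` \<V>"]
      openin_preimage \<V> by blast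
  have "\<forall>U\<in>\<U>. \<exists>V. V \<in> \<V> \<and> U \<subseteq> {x \<in> topspace X. f x \<in> V}" using \<U>(2) by blast
  then obtain v where v: "\<And>U. U \<in> \<U> \<Longrightarrow> v U \<in> \<V>"
      "\<And>U. U \<in> \<U> \<Longrightarrow> U \<subseteq> {x \<in> topspace X. f x \<in> v U}"
    by metis
  have X'cov: "X' \<subseteq> \<Union>\<U>"
  proof -
    have "X' \<subseteq> \<Union>((\<lambda>V. {x \<in> topspace X. f x \<in> V}) ` \<V>)"
      using cov nonisolated_subset[of X] by fastforce
    then show ?thesis using \<U>(3) by blast
  qed
  define fib where "fib z = {x \<in> X'. f x = z}" for z
  define covers where "covers z k = {F. F \<subseteq> \<U> \<and> finite F \<and> card F = k \<and> fib z \<subseteq> \<Union>F}" for z k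
  define k where "k z = (LEAST k. covers z k \<noteq> {})" for z
  define \<Phi> where "\<Phi> z = covers z (k z)" for z
  have ne: "\<Phi> z \<noteq> {}" if "z \<in> Y'" for z
  proof -
    have "fib z = X' \<inter> {x \<in> topspace X. f x = z}"
      using nonisolated_subset[of X] by (auto simp: fib_def)
    then have "compactin X (fib z)"
      using that Y'_subset
      by (auto intro!: closed_Int_compactin closedin_nonisolated compact_fibre)
    moreover have "fib z \<subseteq> \<Union>\<U>" using X'cov by (auto simp: fib_def)
    ultimately obtain F where "finite F" "F \<subseteq> \<U>" "fib z \<subseteq> \<Union>F"
      using \<U>(1) unfolding compactin_def by metis
    then have "covers z (card F) \<noteq> {}" by (auto simp: covers_def)
    then show ?thesis unfolding \<Phi>_def k_def by (rule LeastI)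
  qed
  have fin: "finite (\<Phi> z)" for z
    unfolding \<Phi>_def covers_def
  proof (rule finite_minimum_covers)
    show "finite {U \<in> \<U>. x \<in> U}" if "x \<in> fib z" for x
      using \<U>(4) that by (auto simp: fib_def point_finite_on_def)
    show "k z \<le> card F" if "F \<subseteq> \<U>" "finite F" "fib z \<subseteq> \<Union>F" for F
      unfolding k_def using that by (intro Least_le) (auto simp: covers_def)
  qed
  \<comment> \<open>On \<open>N z\<close> every minimum cover at \<open>z\<close> still covers the
    fibre, so \<open>k\<close> can only drop there. Finiteness of \<open>\<Phi> z\<close> makes
    \<open>N z\<close> open.\<close>
  define N where "N z = {y \<in> topspace Y. \<forall>F\<in>\<Phi> z. fib y \<subseteq> \<Union>F}" for z
  have N_open: "openin Y (N z)" if "z \<in> Y'" for z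
  proof -
    have "N z = \<Inter>((\<lambda>F. {y \<in> topspace Y. \<forall>x\<in>X'. f x = y \<longrightarrow> x \<in> \<Union>F}) ` \<Phi> z)"
      using ne[OF that] by (auto simp: N_def fib_def)
    also have "openin Y \<dots>"
    proof (rule openin_Inter)
      fix A assume "A \<in> (\<lambda>F. {y \<in> topspace Y. \<forall>x\<in>X'. f x = y \<longrightarrow> x \<in> \<Union>F}) ` \<Phi> z"
      then obtain F where F: "F \<in> \<Phi> z" "A = {y \<in> topspace Y. \<forall>x\<in>X'. f x = y \<longrightarrow> x \<in> \<Union>F}"
        by blast
      have "openin X (\<Union>F)" using F(1) \<U>(1) by (auto simp: \<Phi>_def covers_def)
      then show "openin Y A" unfolding F(2)
        by (rule openin_fibres_within[OF closedin_nonisolated])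
    qed (use fin ne[OF that] in auto)
    finally show ?thesis .
  qed
  \<comment> \<open>\<open>prod_encode\<close> numbers the strata by a single natural number, as
    \<open>glue_point_finite\<close> expects.\<close>
  define S where "S n = {z \<in> Y'. prod_encode (k z, card (\<Phi> z)) = n}" for n
  have "\<exists>\<Q>. (\<forall>Q\<in>\<Q>. openin Y Q \<and> (\<exists>V\<in>\<V>. Q \<subseteq> V)) \<and> S n \<subseteq> \<Union>\<Q> \<and> point_finite_on Y' \<Q>"
    for n
  proof -
    \<comment> \<open>Equal \<open>k\<close> makes the covers in \<open>\<Phi> z\<close> minimum
      covers at \<open>z'\<close>; equal finite cardinality excludes any others.\<close>
    have same: "\<Phi> z' = \<Phi> z" if z: "z \<in> S n" "z' \<in> S n" "z' \<in> N z" for z z'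
    proof -
      have "prod_encode (k z, card (\<Phi> z)) = prod_encode (k z', card (\<Phi> z'))"
        using z by (simp add: S_def)
      then have eq: "k z' = k z" "card (\<Phi> z') = card (\<Phi> z)" by auto
      have "\<Phi> z \<subseteq> \<Phi> z'" using z(3) by (auto simp: N_def \<Phi>_def eq covers_def)
      then show ?thesis using eq fin by (metis card_subset_eq)
    qed
    have zN: "z \<in> N z" if "z \<in> S n" for z
      using that Y'_subset by (auto simp: N_def S_def \<Phi>_def covers_def)
    have SY: "S n \<subseteq> Y'" by (auto simp: S_def)
    have "openin Y (N z)" if "z \<in> S n" for z using N_open SY that by blast
    from discrete_expansion[of "S n" N \<Phi>, OF SY this zN same]
    obtain Q where "(\<forall>d. openin Y (Q d)) \<and> (\<forall>z\<in>S n. z \<in> Q (\<Phi> z)) \<and>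
        (\<forall>y\<in>Y'. finite {d \<in> \<Phi> ` S n. y \<in> Q d})"
      by (rule exE)
    then have Q: "\<And>d. openin Y (Q d)" "\<And>z. z \<in> S n \<Longrightarrow> z \<in> Q (\<Phi> z)"
        "\<And>y. y \<in> Y' \<Longrightarrow> finite {d \<in> \<Phi> ` S n. y \<in> Q d}"
      by blast+
    \<comment> \<open>One minimum cover is selected per class, so each class contributes only
      finitely many sets \<open>Q d \<inter> v U\<close>.\<close>
    define g where "g d = (SOME F. F \<in> d)" for d :: "'a set set set"
    have g: "g (\<Phi> z) \<in> \<Phi> z" if "z \<in> S n" for z
      unfolding g_def using ne[of z] that SY by (simp add: some_in_eq subsetD)
    define \<Q> where "\<Q> = (\<Union>d\<in>\<Phi> ` S n. (\<lambda>U. Q d \<inter> v U) ` g d)"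
    have gU: "U \<in> \<U>" if "d \<in> \<Phi> ` S n" "U \<in> g d" for d U
      using that g by (auto simp: \<Phi>_def covers_def)
    have fing: "finite (g d)" if "d \<in> \<Phi> ` S n" for d
      using that g by (auto simp: \<Phi>_def covers_def)
    have "openin Y A \<and> (\<exists>V\<in>\<V>. A \<subseteq> V)" if A: "A \<in> \<Q>" for A
    proof -
      obtain d U where "A = Q d \<inter> v U" "d \<in> \<Phi> ` S n" "U \<in> g d"
        using A unfolding \<Q>_def by blast
      moreover from this have "v U \<in> \<V>" using gU v(1) by blast
      ultimately show ?thesis using Q(1) \<V> by auto
    qed
    moreover have "S n \<subseteq> \<Union>\<Q>"
    proof
      fix z assume z: "z \<in> S n"
      then obtain x where x: "x \<in> X'" "f x = z" using SY by blast
      then obtain U where U: "U \<in> g (\<Phi> z)" "x \<in> U"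
        using g[OF z] by (auto simp: \<Phi>_def covers_def fib_def)
      then have "z \<in> v U" using v(2)[of U] gU[of "\<Phi> z" U] z x by blast
      then show "z \<in> \<Union>\<Q>" using Q(2)[OF z] z U by (auto simp: \<Q>_def)
    qed
    moreover have "point_finite_on Y' \<Q>"
      unfolding point_finite_on_def
    proof
      fix y assume y: "y \<in> Y'"
      have "{A \<in> \<Q>. y \<in> A} \<subseteq> (\<Union>d\<in>{d \<in> \<Phi> ` S n. y \<in> Q d}. (\<lambda>U. Q d \<inter> v U) ` g d)"
        by (auto simp: \<Q>_def)
      moreover have "finite (\<Union>d\<in>{d \<in> \<Phi> ` S n. y \<in> Q d}. (\<lambda>U. Q d \<inter> v U) ` g d)"
        using Q(3)[OF y] fing by auto
      ultimately show "finite {A \<in> \<Q>. y \<in> A}" using finite_subset by blast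
    qed
    ultimately show ?thesis by blast
  qed
  then obtain \<Q> where \<Q>: "\<And>n. (\<forall>Q\<in>\<Q> n. openin Y Q \<and> (\<exists>V\<in>\<V>. Q \<subseteq> V)) \<and> S n \<subseteq> \<Union>(\<Q> n) \<and>
      point_finite_on Y' (\<Q> n)"
    by metis
  have "Y' \<subseteq> (\<Union>n. \<Union>(\<Q> n))"
  proof
    fix y assume "y \<in> Y'"
    then have "y \<in> S (prod_encode (k y, card (\<Phi> y)))" by (simp add: S_def)
    moreover have "S n \<subseteq> \<Union>(\<Q> n)" for n using \<Q> by simp
    ultimately show "y \<in> (\<Union>n. \<Union>(\<Q> n))" by (meson UN_I UNIV_I subsetD)
  qed
  then obtain \<R> where \<R>: "\<And>R. R \<in> \<R> \<Longrightarrow> openin Y R" "\<And>R. R \<in> \<R> \<Longrightarrow> \<exists>i. \<exists>Q\<in>\<Q> i. R \<subseteq> Q"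
    "Y' \<subseteq> \<Union>\<R>" "point_finite_on Y' \<R>"
    using glue_point_finite[of \<Q>] \<Q> by metis
  moreover have "\<exists>V\<in>\<V>. R \<subseteq> V" if "R \<in> \<R>" for R
  proof -
    obtain i Q where "Q \<in> \<Q> i" "R \<subseteq> Q" using \<R>(2)[OF \<open>R \<in> \<R>\<close>] by blast
    moreover obtain V where "V \<in> \<V>" "Q \<subseteq> V" using \<Q> \<open>Q \<in> \<Q> i\<close> by metis
    ultimately show ?thesis by blast
  qed
  ultimately show thesis by (intro that)
qed

section \<open>A development of \<open>Y\<close> on \<open>Y'\<close>\<close>

text \<open>Shrinking is used twice: compactness controls \<open>H n\<close> near the whole fibre of
  \<open>y\<close>, and the stars at one non-isolated point over \<open>y\<close> force the centre
  \<open>z\<close> of any late \<open>V n z\<close> containing \<open>y\<close> to be near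
  \<open>y\<close>.\<close>

lemma development_image:
  obtains \<V> where "development_on Y Y' \<V>"
proof -
  obtain \<U> where dev: "development_on X X' \<U>" and pf_U: "\<And>n. point_finite_on X' (\<U> n)"
    using development by blast
  note \<U> = development_onD(1,2)[OF dev] pf_U development_onD(3)[OF dev]
  \<comment> \<open>Using all covers up to \<open>n\<close> puts \<open>H n x\<close> inside the
    members at \<open>x\<close> of earlier covers too.\<close>
  define \<T> where "\<T> n x = {U \<in> (\<Union>m\<le>n. \<U> m). x \<in> U}" for n x
  define H where "H n x = (if x \<in> X' then \<Inter>(\<T> n x) else {x})" for n x
  have H_open: "openin X (H n x)" if "x \<in> topspace X" for n x
  proof (cases "x \<in> X'")
    case True
    have "\<T> n x = (\<Union>m\<le>n. {U \<in> \<U> m. x \<in> U})" by (auto simp: \<T>_def)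
    then have "finite (\<T> n x)" using \<U>(3) True by (simp add: point_finite_on_def)
    moreover have "\<T> n x \<noteq> {}" using \<U>(2)[of n] True unfolding \<T>_def by blast
    ultimately have "openin X (\<Inter>(\<T> n x))"
      using \<U>(1) by (intro openin_Inter) (auto simp: \<T>_def)
    then show ?thesis using True by (simp add: H_def)
  next
    case False
    then show ?thesis using that by (simp add: H_def nonisolated_def isolated_point_def)
  qed
  have H_self: "x \<in> H n x" for n x by (auto simp: H_def \<T>_def)
  have H_subset: "H n x \<subseteq> U" if "U \<in> \<U> m" "m \<le> n" "x \<in> U" for n m x U
    using that by (auto simp: H_def \<T>_def)
  define V where "V n z = {y \<in> topspace Y. \<forall>x\<in>topspace X. f x = y \<longrightarrow>
      x \<in> (\<Union>x'\<in>{x' \<in> topspace X. f x' = z}. H n x')}" for n z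
  have small: "\<exists>n0. \<forall>n\<ge>n0. \<forall>z. y \<in> V n z \<longrightarrow> V n z \<subseteq> W"
    if y: "y \<in> Y'" and W: "openin Y W" "y \<in> W" for y W
  proof -
    define W' where "W' = {x \<in> topspace X. f x \<in> W}"
    have W': "openin X W'" unfolding W'_def by (rule openin_preimage[OF W(1)])
    define K where "K = {x \<in> topspace X. f x = y}"
    have K: "compactin X K" unfolding K_def using y Y'_subset by (intro compact_fibre) blast
    have KW: "K \<subseteq> W'" using W by (auto simp: K_def W'_def)
    \<comment> \<open>For non-isolated \<open>p\<close>, a member of \<open>\<U> m\<close> inside
      \<open>W'\<close> serves as \<open>G\<close>: it contains \<open>H n x\<close> for each of its
      points \<open>x\<close> once \<open>m \<le> n\<close>. For isolated \<open>p\<close>,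
      \<open>H n p = {p}\<close>.\<close>
    have "\<exists>G m. openin X G \<and> p \<in> G \<and> (\<forall>n\<ge>m. \<forall>x\<in>G. H n x \<subseteq> W')" if p: "p \<in> K" for p
    proof (cases "p \<in> X'")
      case True
      have "p \<in> W'" using p KW by blast
      from \<U>(4)[OF True W' this] obtain m where "\<forall>n\<ge>m. \<forall>U\<in>\<U> n. p \<in> U \<longrightarrow> U \<subseteq> W'" by (rule exE)
      then have m: "U \<subseteq> W'" if "U \<in> \<U> m" "p \<in> U" for U
        using that order_refl[of m] by blast
      obtain G where G: "G \<in> \<U> m" "p \<in> G" using \<U>(2) True by blast
      have "H n x \<subseteq> W'" if "m \<le> n" "x \<in> G" for n x
        using H_subset[OF G(1) that] m[OF G] by (rule subset_trans)
      moreover have "openin X G" using \<U>(1)[OF G(1)] .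
      ultimately show ?thesis using G(2) by (intro exI[of _ G] exI[of _ m]) simp
    next
      case False
      then have "openin X {p}" "\<forall>n\<ge>0. \<forall>x\<in>{p}. H n x \<subseteq> W'"
        using p KW by (auto simp: K_def nonisolated_def isolated_point_def H_def)
      then show ?thesis by blast
    qed
    then obtain G m where G: "\<And>p. p \<in> K \<Longrightarrow> openin X (G p)" "\<And>p. p \<in> K \<Longrightarrow> p \<in> G p"
        "\<And>p n x. p \<in> K \<Longrightarrow> m p \<le> n \<Longrightarrow> x \<in> G p \<Longrightarrow> H n x \<subseteq> W'"
      by metis
    have "\<And>A. A \<in> G ` K \<Longrightarrow> openin X A" "K \<subseteq> \<Union>(G ` K)" using G by auto
    then obtain \<F> where "finite \<F>" "\<F> \<subseteq> G ` K" "K \<subseteq> \<Union>\<F>"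
      using K unfolding compactin_def by meson
    then obtain B where B: "finite B" "B \<subseteq> K" "K \<subseteq> \<Union>(G ` B)"
      by (metis finite_subset_image)
    define W1 where "W1 = {y' \<in> topspace Y. \<forall>x\<in>topspace X. f x = y' \<longrightarrow> x \<in> \<Union>(G ` B)}"
    have "openin Y W1"
      unfolding W1_def using G(1) B(2) by (intro openin_fibres_within) auto
    then have W1': "openin X {x \<in> topspace X. f x \<in> W1}" by (rule openin_preimage)
    obtain x where x: "x \<in> X'" "f x = y" using y by blast
    have "y \<in> W1" using B(3) y Y'_subset by (auto simp: W1_def K_def)
    then have xW1: "x \<in> {x \<in> topspace X. f x \<in> W1}"
      using x nonisolated_subset[of X] by blast
    obtain n1 where n1: "\<And>n U. n \<ge> n1 \<Longrightarrow> U \<in> \<U> n \<Longrightarrow> x \<in> U \<Longrightarrow>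
        U \<subseteq> {x \<in> topspace X. f x \<in> W1}"
      using \<U>(4)[OF x(1) W1' xW1] by metis
    define n0 where "n0 = Max (insert n1 (m ` B))"
    have "V n z \<subseteq> W" if n: "n0 \<le> n" and yV: "y \<in> V n z" for n z
    proof -
      have n_ge: "n1 \<le> n" "\<And>p. p \<in> B \<Longrightarrow> m p \<le> n"
        using n B(1) by (auto simp: n0_def)
      have "x \<in> topspace X" using x nonisolated_subset[of X] by blast
      then obtain x' where x': "x' \<in> topspace X" "f x' = z" "x \<in> H n x'"
        using yV x by (auto simp: V_def)
      \<comment> \<open>For isolated \<open>x'\<close>, \<open>H n x' = {x'}\<close> would make
        \<open>x\<close> isolated.\<close>
      then have "x' \<in> X'" using x by (auto simp: H_def split: if_splits)
      then obtain U where U: "U \<in> \<U> n" "x' \<in> U" using \<U>(2) by blast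
      then have "x \<in> U" using H_subset[of U n n x'] x' by blast
      \<comment> \<open>The star at \<open>x\<close> catches \<open>x'\<close>, so the fibre of
        \<open>z\<close> is covered by the finitely many \<open>G p\<close>.\<close>
      then have "z \<in> W1" using n1[OF n_ge(1) U(1)] U x' by blast
      have HW: "H n x'' \<subseteq> W'" if x'': "x'' \<in> topspace X" "f x'' = z" for x''
      proof -
        obtain p where "p \<in> B" "x'' \<in> G p"
          using \<open>z \<in> W1\<close> x'' by (auto simp: W1_def)
        then show ?thesis using G(3)[of p n x''] B(2) n_ge(2) by blast
      qed
      show ?thesis
      proof
        fix y' assume y': "y' \<in> V n z"
        then have "y' \<in> f ` topspace X" using surj by (simp add: V_def)
        then obtain w where w: "w \<in> topspace X" "f w = y'" by blast
        have "w \<in> (\<Union>x''\<in>{x'' \<in> topspace X. f x'' = z}. H n x'')"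
          using y' w by (simp add: V_def)
        then have "w \<in> W'" using HW by blast
        then show "y' \<in> W" using w by (simp add: W'_def)
      qed
    qed
    then show ?thesis by blast
  qed
  have "openin Y (V n z)" for n z
    unfolding V_def by (rule openin_fibres_within) (auto intro: H_open)
  moreover have "y \<in> V n y" if "y \<in> Y'" for n y
    using that Y'_subset H_self by (auto simp: V_def)
  moreover have "\<exists>n0. \<forall>n\<ge>n0. \<forall>A\<in>V n ` Y'. y \<in> A \<longrightarrow> A \<subseteq> W"
    if "y \<in> Y'" "openin Y W" "y \<in> W" for y W
    using small[OF that] by (elim ex_forward) simp
  ultimately have "development_on Y Y' (\<lambda>n. V n ` Y')"
    unfolding development_on_def by (intro conjI allI ballI impI) (blast+)
  then show thesis by (rule that)
qed

section \<open>The uniform base of \<open>Y\<close>\<close>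

lemma uniform_base_image: "has_uniform_base_at_nonisolated Y"
proof -
  obtain \<V> where "development_on Y Y' \<V>"
    using development_image by blast
  note \<V> = development_onD[OF this]
  have "\<exists>\<R>. (\<forall>R\<in>\<R>. openin Y R) \<and> (\<forall>R\<in>\<R>. \<exists>V\<in>\<V> n. R \<subseteq> V) \<and> Y' \<subseteq> \<Union>\<R> \<and> point_finite_on Y' \<R>"
    for n
    using point_finite_refinement_image[of "\<V> n"] \<V>(1)[of _ n] \<V>(2)[of n] by metis
  then obtain \<R> where \<R>: "\<And>n. (\<forall>R\<in>\<R> n. openin Y R) \<and> (\<forall>R\<in>\<R> n. \<exists>V\<in>\<V> n. R \<subseteq> V) \<and>
      Y' \<subseteq> \<Union>(\<R> n) \<and> point_finite_on Y' (\<R> n)"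
    by metis
  have small: "\<exists>n0. \<forall>n\<ge>n0. \<forall>R\<in>\<R> n. y \<in> R \<longrightarrow> R \<subseteq> W"
    if y: "y \<in> Y'" "openin Y W" "y \<in> W" for y W
  proof -
    obtain n0 where n0: "\<And>n V. n \<ge> n0 \<Longrightarrow> V \<in> \<V> n \<Longrightarrow> y \<in> V \<Longrightarrow> V \<subseteq> W"
      using \<V>(3)[OF y] by metis
    have "R \<subseteq> W" if "n0 \<le> n" "R \<in> \<R> n" "y \<in> R" for n R
    proof -
      have "\<exists>V\<in>\<V> n. R \<subseteq> V" using \<R> \<open>R \<in> \<R> n\<close> by simp
      then obtain V where "V \<in> \<V> n" "R \<subseteq> V" ..
      then show ?thesis using n0[of n V] that(1,3) by blast
    qed
    then show ?thesis by blast
  qed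
  \<comment> \<open>The singletons serve the isolated points of \<open>Y\<close>; none of them
    contains a non-isolated point.\<close>
  define \<B> where "\<B> = (\<Union>n. \<R> n) \<union> {{y} |y. openin Y {y}}"
  have B_open: "openin Y B" if "B \<in> \<B>" for B using that \<R> by (auto simp: \<B>_def)
  have "base_of Y \<B>"
    unfolding base_of_alt
  proof (intro conjI ballI allI impI)
    show "openin Y B" if "B \<in> \<B>" for B using that by (rule B_open)
    fix W y assume W: "openin Y W \<and> y \<in> W"
    show "\<exists>P\<in>\<B>. y \<in> P \<and> P \<subseteq> W"
    proof (cases "y \<in> nonisolated Y")
      case True
      then have y: "y \<in> Y'" using nonisolated_image by blast
      then obtain n where n: "\<And>R. R \<in> \<R> n \<Longrightarrow> y \<in> R \<Longrightarrow> R \<subseteq> W" using small[OF y, of W] W by (metis order_refl)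
      obtain R where "R \<in> \<R> n" "y \<in> R" using \<R> y by blast
      then show ?thesis using n by (auto simp: \<B>_def)
    next
      case False
      then have "openin Y {y}"
        using W openin_subset[of Y W] by (auto simp: nonisolated_def isolated_point_def)
      then show ?thesis using W by (auto simp: \<B>_def)
    qed
  qed
  moreover have "nbhd_base_at Y y \<P>'"
    if y: "y \<in> topspace Y" "\<not> isolated_point Y y"
      and P': "\<P>' \<subseteq> {P \<in> \<B>. y \<in> P}" "infinite \<P>'" for y \<P>'
    unfolding nbhd_base_at_def
  proof (intro conjI ballI allI impI)
    show "N \<subseteq> topspace Y" if "N \<in> \<P>'" for N using that P' B_open openin_subset by blast
    show "\<exists>U. openin Y U \<and> y \<in> U \<and> U \<subseteq> N" if "N \<in> \<P>'" for N using that P' B_open by blast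
    have y': "y \<in> Y'" using y nonisolated_image by (auto simp: nonisolated_def)
    fix W assume "openin Y W \<and> y \<in> W"
    then obtain n0 where n0: "\<And>n R. n \<ge> n0 \<Longrightarrow> R \<in> \<R> n \<Longrightarrow> y \<in> R \<Longrightarrow> R \<subseteq> W"
      using small[OF y'] by metis
    \<comment> \<open>Only finitely many members at \<open>y\<close> come from the first
      \<open>n0\<close> families, so the infinite \<open>\<P>'\<close> has a member from a later
      one, which lies in \<open>W\<close>.\<close>
    have "finite (\<Union>n<n0. {R \<in> \<R> n. y \<in> R})"
      using \<R> y' by (auto simp: point_finite_on_def)
    then obtain N where N: "N \<in> \<P>'" "N \<notin> (\<Union>n<n0. {R \<in> \<R> n. y \<in> R})"
      using P'(2) by (meson finite_subset subsetI)
    then have "N \<in> \<B>" "y \<in> N" using P' by auto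
    then obtain n where n: "N \<in> \<R> n" using y(2) by (auto simp: \<B>_def isolated_point_def)
    have "\<not> n < n0" using n N(2) \<open>y \<in> N\<close> by blast
    then have "N \<subseteq> W" using n0[of n N] n \<open>y \<in> N\<close> by simp
    then show "\<exists>N\<in>\<P>'. N \<subseteq> W" using N(1) by blast
  qed
  ultimately show ?thesis
    unfolding has_uniform_base_at_nonisolated_def uniform_base_at_nonisolated_def by blast
qed

end

theorem corollary3p4:
  fixes X :: "'a topology" and Y :: "'b topology" and f :: "'a \<Rightarrow> 'b"
  assumes "Hausdorff_space X"
    and "Hausdorff_space Y"
    and "perfect_map X Y f"
    and "has_uniform_base_at_nonisolated X"
  shows "has_uniform_base_at_nonisolated Y"
proof -
  obtain \<P> where "uniform_base_at_nonisolated X \<P>"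
    using assms(4) by (auto simp: has_uniform_base_at_nonisolated_def)
  then interpret perfect_image X \<P> Y f
    using assms by unfold_locales
  show ?thesis by (rule uniform_base_image)
qed

end
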